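(* Fix $d\ge 3$, $\delta\in(-\infty,d-1)$, $c\in(0,\infty)$, let $p=(c+o_n(1))n^{-d+1+\delta}$ and let $\mathcal{H}$ be the random $d$-uniform hypergraph on $[n]$ with each $d$-subset a hyperedge independently with probability $p$. If $\delta<\frac{d-1}{d+1}$ then the probability of weighted exact recovery is $1-o_n(1)$; if $\delta>\frac{d-1}{d+1}$ then it is $o_n(1)$.
   Context: $\mathrm{Proj}_W(H)$ is the edge-weighted graph on $[n]$ where the weight of $\{i,j\}$ is the number of hyperedges of $H$ containing $\{i,j\}$. The probability of weighted exact recovery is the maximum over all functions $\mathcal{A}_W$ from weighted projections to $d$-uniform hypergraphs on $[n]$ of $\Pr[\mathcal{A}_W(\mathrm{Proj}_W(\mathcal{H}))=\mathcal{H}]$ (attained by the MAP estimator). Asymptotics are as $n\to\infty$. *)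

theory Defs
  imports "HOL-Probability.Probability" "HOL-Library.Ramsey"
begin

definition hypergraphs :: "nat \<Rightarrow> nat \<Rightarrow> nat set set set" where
  "hypergraphs n d = Pow (nsets {1..n} d)"

text \<open>
  The weighted projection is an edge-weighted graph on \<open>{1..n}\<close>, encoded by its weight function
  on two-element subsets. Arguments that are not pairs of vertices get the dummy weight \<open>0\<close>.
\<close>

definition weighted_proj :: "nat \<Rightarrow> nat set set \<Rightarrow> nat set \<Rightarrow> nat" where
  "weighted_proj n H e = (if e \<in> nsets {1..n} 2 then card {h \<in> H. e \<subseteq> h} else 0)"

text \<open>
  \<^const>\<open>bernoulli_pmf\<close> clamps its parameter to \<open>[0, 1]\<close>, so \<open>p\<close> has its intended meaning
  only when \<open>0 \<le> p \<le> 1\<close>.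
\<close>

definition random_hypergraph :: "nat \<Rightarrow> nat \<Rightarrow> real \<Rightarrow> nat set set pmf" where
  "random_hypergraph n d p =
     map_pmf (\<lambda>f. {h \<in> nsets {1..n} d. f h})
       (Pi_pmf (nsets {1..n} d) False (\<lambda>_. bernoulli_pmf p))"

definition recovery_maps :: "nat \<Rightarrow> nat \<Rightarrow> ((nat set \<Rightarrow> nat) \<Rightarrow> nat set set) set" where
  "recovery_maps n d = (weighted_proj n ` hypergraphs n d) \<rightarrow>\<^sub>E hypergraphs n d"

definition weighted_recovery_prob :: "nat \<Rightarrow> nat \<Rightarrow> real \<Rightarrow> real" where
  "weighted_recovery_prob n d p =
     Max ((\<lambda>A. measure_pmf.prob (random_hypergraph n d p) {H. A (weighted_proj n H) = H})
            ` recovery_maps n d)"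

text \<open>The maximum is taken over a finite nonempty set.\<close>

lemma finite_recovery_maps: "finite (recovery_maps n d)"
  unfolding recovery_maps_def hypergraphs_def
  by (intro finite_PiE finite_imageI) (auto intro: finite_imp_finite_nsets)

lemma recovery_maps_nonempty: "recovery_maps n d \<noteq> {}"
  unfolding recovery_maps_def hypergraphs_def by (auto simp: PiE_eq_empty_iff)

end

theory Submission
  imports Defs
begin

text \<open>
  Below the threshold: if \<open>H \<noteq> H'\<close> have the same weighted projection, then \<open>A = H - H'\<close> and
  \<open>B = H' - H\<close> are disjoint and cover the same pairs. Grow a subfamily \<open>S\<close> of \<open>A\<close>, starting from one
  hyperedge: either add a hyperedge of \<open>A\<close> that meets \<open>\<Union>S\<close> in two vertices, or take \<open>b \<in> B\<close> that meets
  \<open>\<Union>S\<close> in two vertices and leaves it, and add hyperedges of \<open>A\<close> covering the remaining pairs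
  of \<open>b\<close>. As long as \<open>\<delta> < (d - 1) / (d + 1)\<close>, no step increases \<open>|\<Union>S| - (d - 1 - \<delta>) |S|\<close>; when the
  process stops, every vertex lies in two hyperedges of \<open>S\<close>, so the quantity is negative. With a slightly
  smaller \<open>\<delta>\<close> every step loses a fixed amount, so a subfamily of bounded size has negative excess, and the
  first moment method excludes it.

  Above the threshold: on the recovered hypergraphs the projection is injective. A hypergraph with
  \<open>m\<close> edges has probability at most \<open>p ^ m\<close> and total projected weight \<open>(d choose 2) * m\<close>. Weighting
  weight functions geometrically with ratio \<open>t\<close> of order \<open>min 1 (n powr (\<delta> - 1))\<close> shows that the
  recovered hypergraphs with many edges have total probability at most
  \<open>(p / t ^ (d choose 2)) powr (\<Omega> (n powr (1 + \<delta>))) * exp (O (n powr (1 + \<delta>)))\<close>, and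
  \<open>p / t ^ (d choose 2)\<close> tends to 0 exactly when \<open>\<delta> > (d - 1) / (d + 1)\<close>.
\<close>

section \<open>Pairs of families covering the same pairs\<close>

text \<open>
  For \<open>p = n powr (- d + 1 + \<delta>)\<close>, the expected number of copies of \<open>S\<close> in the random hypergraph
  is of order \<open>n powr excess d \<delta> S\<close>.
\<close>

definition excess :: "nat \<Rightarrow> real \<Rightarrow> 'a set set \<Rightarrow> real" where
  "excess d \<delta> S = real (card (\<Union>S)) - (real d - 1 - \<delta>) * real (card S)"

section \<open>Sharing the gain of a cover among vertices\<close>

text \<open>In the application \<open>u\<close> is |U| and \<open>D\<close> + 1 is |X|, so
  \<open>u + D + 1\<close> is the hyperedge size d and the hypothesis is the threshold \<delta> (d +
  1) < d - 1. A hyperedge is to give each of its vertices in X at least 1 - \<delta> per vertex of U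
  and \<mu> per further vertex of X that it contains. The upper bounds on \<mu> make this affordable
  for the hyperedge (\<open>edge_share_ge\<close>); the last bound says that a vertex joined to all
  of U and all other vertices of X collects at least 1.\<close>

lemma share_weight_exists:
  fixes \<delta> :: real and u D :: nat
  assumes "0 \<le> \<delta>" "\<delta> * (real u + real D + 2) < real u + real D" "u \<ge> 2"
  obtains \<mu> :: real where "\<mu> \<ge> 0" "\<mu> * (real D + 1) \<le> \<delta>"
    "D \<ge> 1 \<Longrightarrow> 2 * \<mu> \<le> 1 - \<delta>" "D \<ge> 1 \<Longrightarrow> \<mu> * (real D * (real D + 1)) \<le> real D - \<delta>"
    "1 \<le> real u * (1 - \<delta>) + \<mu> * real D"
proof -
  have d1: "\<delta> < 1"
  proof (rule ccontr)
    assume "\<not> \<delta> < 1"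
    then have "1 * (real u + real D + 2) \<le> \<delta> * (real u + real D + 2)"
      by (intro mult_right_mono) auto
    with assms(2) show False by (smt (verit))
  qed
  define a where "a = real u - 2"
  have a: "a \<ge> 0" "real u = a + 2" using assms by (auto simp: a_def)
  define E where "E = real D"
  have E: "E \<ge> 0" by (simp add: E_def)
  have ad: "\<delta> * (a + E + 4) < a + E + 2"
    using assms(2) by (simp add: a E_def algebra_simps)
  \<comment> \<open>The last bound for \<mu> = \<delta> / (E + 1), multiplied by E + 1; for E = 0
    nothing more is needed. Multiplying further by a + E + 4 allows the threshold hypothesis to
    replace \<delta>, and a polynomial inequality remains.\<close>
  have big: "(a + 2) * (1 - \<delta>) * (E + 1) + E * \<delta> \<ge> E + 1"
  proof -
    have "\<delta> * ((a+2)*(E+1) - E) * (a+E+4) \<le> (a+E+2) * ((a+2)*(E+1) - E)"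
    proof -
      have "(a+2)*(E+1) - E \<ge> 0" using a E by (simp add: algebra_simps)
      then have "\<delta> * (a+E+4) * ((a+2)*(E+1) - E) \<le> (a+E+2) * ((a+2)*(E+1) - E)"
        using ad by (intro mult_right_mono) auto
      then show ?thesis by (simp add: algebra_simps)
    qed
    also have "\<dots> \<le> (a+1)*(E+1) * (a+E+4)"
    proof -
      have "(a+1)*(E+1) * (a+E+4) - (a+E+2) * ((a+2)*(E+1) - E) = a + E + 2*a*E"
        by (simp add: algebra_simps)
      moreover have "a + E + 2*a*E \<ge> 0" using a E by simp
      ultimately show ?thesis by linarith
    qed
    finally have "\<delta> * ((a+2)*(E+1) - E) \<le> (a+1)*(E+1)"
      using a E by (auto simp: mult_le_cancel_right)
    then show ?thesis by (simp add: algebra_simps)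
  qed
  show thesis
  proof (cases "D = 0")
    case True
    then have "1 \<le> real u * (1 - \<delta>)" using big by (simp add: a E_def)
    with True assms(1) show thesis by (intro that[of 0]) auto
  next
    case False
    then have E1: "E \<ge> 1" by (simp add: E_def)
    \<comment> \<open>These are the largest values that the three upper bounds admit. As \<mu> is
      their minimum, it suffices to check the last bound for each of them.\<close>
    define m1 m2 m3 where "m1 = \<delta> / (E + 1)" and "m2 = (1 - \<delta>) / 2"
      and "m3 = (E - \<delta>) / (E * (E + 1))"
    define \<mu> where "\<mu> = min m1 (min m2 m3)"
    have c1: "1 \<le> real u * (1 - \<delta>) + m1 * E"
    proof -
      have "real u * (1 - \<delta>) + m1 * E = (real u * (1 - \<delta>) * (E + 1) + E * \<delta>) / (E + 1)"
        using E by (simp add: m1_def field_simps)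
      also have "\<dots> \<ge> 1" using big E by (simp add: a)
      finally show ?thesis .
    qed
    have c2: "1 \<le> real u * (1 - \<delta>) + m2 * E"
    proof -
      have "2 \<le> (1 - \<delta>) * (a + E + 4)" using ad by (simp add: algebra_simps)
      moreover have "0 \<le> a * (1 - \<delta>)" using a d1 by simp
      ultimately have "2 + 0 \<le> (1 - \<delta>) * (a + E + 4) + a * (1 - \<delta>)" by (rule add_mono)
      also have "\<dots> = 2 * (real u * (1 - \<delta>) + m2 * E)"
        by (simp add: m2_def a field_simps)
      finally show ?thesis by simp
    qed
    have c3: "1 \<le> real u * (1 - \<delta>) + m3 * E"
    proof -
      have e: "m3 * E = 1 - (1 + \<delta>) / (E + 1)"
        using E1 by (simp add: m3_def divide_simps)
      have "1 + \<delta> \<le> (a + 2) * (1 - \<delta>) * (E + 1)"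
      proof -
        have "\<delta> * (a + E + 4) * ((a+2)*(E+1) + 1) \<le> (a + E + 2) * ((a+2)*(E+1) + 1)"
          using ad a E by (intro mult_right_mono) auto
        also have "\<dots> \<le> ((a+2)*(E+1) - 1) * (a + E + 4)"
        proof -
          have "((a+2)*(E+1) - 1) * (a + E + 4) - (a + E + 2) * ((a+2)*(E+1) + 1)
              = 2 * a * E + 2 * (E - 1)"
            by (simp add: algebra_simps)
          moreover have "2 * a * E + 2 * (E - 1) \<ge> 0" using a E1 by simp
          ultimately show ?thesis by linarith
        qed
        finally have "\<delta> * ((a+2)*(E+1) + 1) * (a + E + 4) \<le> ((a+2)*(E+1) - 1) * (a + E + 4)"
          by (simp add: algebra_simps)
        then have "\<delta> * ((a+2)*(E+1) + 1) \<le> ((a+2)*(E+1) - 1)"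
          using a E by (auto simp: mult_le_cancel_right)
        then show ?thesis by (simp add: algebra_simps)
      qed
      then have "(1 + \<delta>) / (E + 1) \<le> (a + 2) * (1 - \<delta>)"
        using E by (simp add: divide_simps)
      with e show ?thesis by (simp add: a)
    qed
    have pos: "m1 \<ge> 0" "m2 \<ge> 0" "m3 \<ge> 0"
      using assms(1) d1 E1 by (auto simp: m1_def m2_def m3_def)
    show thesis
    proof (rule that[of \<mu>])
      show "\<mu> \<ge> 0" using pos by (simp add: \<mu>_def)
      have "\<mu> * (E + 1) \<le> m1 * (E + 1)" using E by (intro mult_right_mono) (auto simp: \<mu>_def)
      then show "\<mu> * (real D + 1) \<le> \<delta>" using E by (simp add: m1_def E_def)
      have "2 * \<mu> \<le> 2 * m2" by (auto simp: \<mu>_def)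
      then show "2 * \<mu> \<le> 1 - \<delta>" by (simp add: m2_def)
      have "\<mu> * (E * (E + 1)) \<le> m3 * (E * (E + 1))" using E by (intro mult_right_mono) (auto simp: \<mu>_def)
      then show "\<mu> * (real D * (real D + 1)) \<le> real D - \<delta>" using E1 by (simp add: m3_def E_def)
      show "1 \<le> real u * (1 - \<delta>) + \<mu> * real D"
        using c1 c2 c3 by (auto simp: \<mu>_def min_def E_def)
    qed
  qed
qed

text \<open>\<open>t\<close> and \<open>i\<close> count the vertices of a hyperedge in X and in U.
  For \<open>i\<close> = 1 the claim follows from \<mu> t \<le> \<delta>, which is tightest at t = D
  + 1. For \<open>i\<close> = 0, after multiplication by t, the difference of the two sides is
  concave in t, so only the ends t = 2 and t = D + 1 of the range matter; the two conditional
  hypotheses are exactly these cases.\<close>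

lemma edge_share_ge:
  fixes \<delta> \<mu> :: real and t i D :: nat
  assumes "0 \<le> \<delta>" "\<mu> \<ge> 0" "\<mu> * (real D + 1) \<le> \<delta>"
    and "D \<ge> 1 \<Longrightarrow> 2 * \<mu> \<le> 1 - \<delta>" "D \<ge> 1 \<Longrightarrow> \<mu> * (real D * (real D + 1)) \<le> real D - \<delta>"
    and "1 \<le> t" "t \<le> D + 1" "i \<le> 1" "2 \<le> t + i"
  shows "(1 - \<delta>) * real i + \<mu> * (real t - 1) \<le> (real t + real i - 1 - \<delta>) / real t"
proof (cases "i = 0")
  case True
  define T where "T = real t"
  define E where "E = real D"
  have T: "2 \<le> T" "T \<le> E + 1" and D: "D \<ge> 1" using assms True by (auto simp: T_def E_def)
  have q2: "0 \<le> 1 - \<delta> - 2 * \<mu>" using assms D by simp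
  have qD: "0 \<le> E - \<delta> - \<mu> * (E * (E + 1))" using assms(5)[OF D] by (simp add: E_def)
  have "\<mu> * (T - 1) * T \<le> T - 1 - \<delta>"
  proof (cases "D = 1")
    case True
    then have "T = 2" using T by (simp add: E_def)
    then show ?thesis using q2 by simp
  next
    case False
    then have E2: "E > 1" using D by (simp add: E_def)
    \<comment> \<open>Interpolation between T = 2 and T = E + 1; the third summand is the surplus
      from concavity. The factor E - 1 is the length of the range, hence the separate case D =
      1.\<close>
    have "0 \<le> (E + 1 - T) * (1 - \<delta> - 2 * \<mu>) + (T - 2) * (E - \<delta> - \<mu> * (E * (E + 1)))
              + (E - 1) * (\<mu> * ((T - 2) * (E + 1 - T)))"
      using q2 qD T E2 assms(2) by (intro add_nonneg_nonneg mult_nonneg_nonneg) auto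
    also have "\<dots> = (E - 1) * (T - 1 - \<delta> - \<mu> * (T - 1) * T)" by (simp add: algebra_simps)
    finally show ?thesis using E2 by (simp add: zero_le_mult_iff)
  qed
  then show ?thesis using T True by (simp add: T_def[symmetric] divide_simps)
next
  case False
  then have i: "i = 1" using assms by simp
  define T where "T = real t"
  have T: "1 \<le> T" "T \<le> real D + 1" using assms by (auto simp: T_def)
  have "\<mu> * T \<le> \<mu> * (real D + 1)" using T assms by (intro mult_left_mono) auto
  then have "\<mu> * T \<le> \<delta>" using assms by simp
  then have "(T - 1) * (\<mu> * T) \<le> (T - 1) * \<delta>" using T by (intro mult_left_mono) auto
  then have "((1 - \<delta>) + \<mu> * (T - 1)) * T \<le> T - \<delta>" by (simp add: algebra_simps)
  then show ?thesis using T i by (simp add: T_def[symmetric] pos_le_divide_eq)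
qed

text \<open>
  Each \<open>h \<in> T\<close> distributes its gain equally among the vertices of \<open>h \<inter> X\<close>; every
  vertex of \<open>X\<close> then receives at least 1.
\<close>

lemma cover_gain_ge:
  fixes \<delta> :: real and U X :: "'a set" and T :: "'a set set"
  assumes "0 \<le> \<delta>" "\<delta> * (real (card U + card X) + 1) < real (card U + card X) - 1"
    and fin: "finite U" "finite X" "finite T" and disj: "U \<inter> X = {}" and "card U \<ge> 2"
    and T: "\<And>h. h \<in> T \<Longrightarrow> card (h \<inter> U) \<le> 1"
    "\<And>h. h \<in> T \<Longrightarrow> card (h \<inter> X) \<ge> 1" "\<And>h. h \<in> T \<Longrightarrow> card (h \<inter> (U \<union> X)) \<ge> 2"
    and cov: "\<And>x y. x \<in> X \<Longrightarrow> y \<in> U \<union> X \<Longrightarrow> x \<noteq> y \<Longrightarrow> \<exists>h\<in>T. x \<in> h \<and> y \<in> h"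
  shows "real (card X) \<le> (\<Sum>h\<in>T. real (card (h \<inter> (U \<union> X))) - 1 - \<delta>)"
proof (cases "X = {}")
  case True
  with T(2) have "T = {}" by fastforce
  with True show ?thesis by simp
next
  case False
  define D where "D = card X - 1"
  have cX: "card X = D + 1" using False fin by (auto simp: D_def card_gt_0_iff Suc_leI)
  obtain \<mu> :: real where mu: "\<mu> \<ge> 0" "\<mu> * (real D + 1) \<le> \<delta>"
    "D \<ge> 1 \<Longrightarrow> 2 * \<mu> \<le> 1 - \<delta>" "D \<ge> 1 \<Longrightarrow> \<mu> * (real D * (real D + 1)) \<le> real D - \<delta>"
    "1 \<le> real (card U) * (1 - \<delta>) + \<mu> * real D"
    by (rule share_weight_exists[of \<delta> "card U" D]) (use assms cX in \<open>auto simp: algebra_simps\<close>)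
  have d1: "\<delta> \<le> 1"
  proof (rule ccontr)
    assume "\<not> \<delta> \<le> 1"
    then have "1 * (real (card U + card X) + 1) \<le> \<delta> * (real (card U + card X) + 1)"
      by (intro mult_right_mono) auto
    with assms(2) show False by (smt (verit))
  qed
  have split: "card (h \<inter> (U \<union> X)) = card (h \<inter> U) + card (h \<inter> X)" for h
  proof -
    have "h \<inter> (U \<union> X) = (h \<inter> U) \<union> (h \<inter> X)" by blast
    then show ?thesis using fin disj by (simp add: card_Un_disjoint Int_left_commute Int_assoc disjoint_iff)
  qed
  define sh where "sh h = (real (card (h \<inter> (U \<union> X))) - 1 - \<delta>) / real (card (h \<inter> X))" for h
  have sh: "(1 - \<delta>) * real (card (h \<inter> U)) + \<mu> * (real (card (h \<inter> X)) - 1) \<le> sh h"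
    if "h \<in> T" for h
  proof -
    have "card (h \<inter> X) \<le> card X" using fin by (intro card_mono) auto
    then show ?thesis unfolding sh_def
      using edge_share_ge[OF \<open>0 \<le> \<delta>\<close> mu(1-4), of "card (h \<inter> X)" "card (h \<inter> U)"]
        T[OF that] cX split[of h] by (simp add: add.commute)
  qed
  \<comment> \<open>\<open>x\<close> shares a hyperedge of \<open>T\<close> with every vertex of
    \<open>U\<close> and every other vertex of \<open>X\<close>, so the shares \<open>sh\<close>
    that it receives add up to at least (1 - \<delta>) |U| + \<mu> D.\<close>
  have one: "1 \<le> (\<Sum>h\<in>{h\<in>T. x \<in> h}. sh h)" if x: "x \<in> X" for x
  proof -
    let ?Tx = "{h\<in>T. x \<in> h}"
    have "card U \<le> card (\<Union>h\<in>?Tx. h \<inter> U)"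
    proof (rule card_mono)
      show "finite (\<Union>h\<in>?Tx. h \<inter> U)" using fin by simp
      show "U \<subseteq> (\<Union>h\<in>?Tx. h \<inter> U)"
      proof
        fix y assume y: "y \<in> U"
        then have "x \<noteq> y" using x disj by blast
        with cov[OF x, of y] y show "y \<in> (\<Union>h\<in>?Tx. h \<inter> U)" by auto
      qed
    qed
    also have "\<dots> \<le> (\<Sum>h\<in>?Tx. card (h \<inter> U))" using fin by (intro card_UN_le) auto
    finally have a: "real (card U) \<le> (\<Sum>h\<in>?Tx. real (card (h \<inter> U)))"
      by (metis of_nat_le_iff of_nat_sum)
    have "D = card (X - {x})" using x fin by (simp add: D_def)
    also have "\<dots> \<le> card (\<Union>h\<in>?Tx. h \<inter> X - {x})"
    proof (rule card_mono)
      show "finite (\<Union>h\<in>?Tx. h \<inter> X - {x})" using fin by simp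
      show "X - {x} \<subseteq> (\<Union>h\<in>?Tx. h \<inter> X - {x})"
      proof
        fix y assume "y \<in> X - {x}"
        with cov[OF x, of y] show "y \<in> (\<Union>h\<in>?Tx. h \<inter> X - {x})" by auto
      qed
    qed
    also have "\<dots> \<le> (\<Sum>h\<in>?Tx. card (h \<inter> X - {x}))" using fin by (intro card_UN_le) auto
    finally have "real D \<le> (\<Sum>h\<in>?Tx. real (card (h \<inter> X - {x})))"
      by (metis of_nat_le_iff of_nat_sum)
    also have "\<dots> = (\<Sum>h\<in>?Tx. real (card (h \<inter> X)) - 1)"
    proof (intro sum.cong refl)
      fix h assume h: "h \<in> ?Tx"
      then have "card (h \<inter> X) \<ge> 1" using T by simp
      then show "real (card (h \<inter> X - {x})) = real (card (h \<inter> X)) - 1"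
        using h x fin by (simp add: card_Diff_singleton of_nat_diff)
    qed
    finally have b: "real D \<le> (\<Sum>h\<in>?Tx. real (card (h \<inter> X)) - 1)" .
    have "1 \<le> (1 - \<delta>) * real (card U) + \<mu> * real D" using mu(5) by (simp add: mult.commute)
    also have "\<dots> \<le> (1 - \<delta>) * (\<Sum>h\<in>?Tx. real (card (h \<inter> U)))
                     + \<mu> * (\<Sum>h\<in>?Tx. real (card (h \<inter> X)) - 1)"
      using a b mu(1) d1 by (intro add_mono mult_left_mono) auto
    also have "\<dots> = (\<Sum>h\<in>?Tx. (1 - \<delta>) * real (card (h \<inter> U)) + \<mu> * (real (card (h \<inter> X)) - 1))"
      by (simp add: sum.distrib sum_distrib_left)
    also have "\<dots> \<le> (\<Sum>h\<in>?Tx. sh h)" by (intro sum_mono sh) auto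
    finally show ?thesis .
  qed
  have "real (card X) = (\<Sum>x\<in>X. 1)" by simp
  also have "\<dots> \<le> (\<Sum>x\<in>X. \<Sum>h\<in>{h\<in>T. x \<in> h}. sh h)" by (intro sum_mono one)
  also have "\<dots> = (\<Sum>h\<in>T. \<Sum>x\<in>{x\<in>X. x \<in> h}. sh h)"
    using fin by (intro sum.swap_restrict) auto
  also have "\<dots> = (\<Sum>h\<in>T. real (card (h \<inter> (U \<union> X))) - 1 - \<delta>)"
  proof (intro sum.cong refl)
    fix h assume "h \<in> T"
    moreover have "{x\<in>X. x \<in> h} = h \<inter> X" by blast
    ultimately show "(\<Sum>x\<in>{x\<in>X. x \<in> h}. sh h) = real (card (h \<inter> (U \<union> X))) - 1 - \<delta>"
      using T(2)[of h] by (simp add: sh_def)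
  qed
  finally show ?thesis .
qed

section \<open>Growing a subfamily of negative excess\<close>

lemma excess_singleton: "card h = d \<Longrightarrow> excess d \<delta> {h} = 1 + \<delta>"
  by (simp add: excess_def)

text \<open>This converts a process that never increases the excess for \<delta>' into one that
  loses a fixed amount per hyperedge for a smaller \<delta>.\<close>

lemma excess_shift: "excess d \<delta> S = excess d \<delta>' S - (\<delta>' - \<delta>) * real (card S)"
  by (simp add: excess_def algebra_simps)

text \<open>The intended instance is \<open>A\<close> = H - H' and \<open>B\<close> = H' - H for
  hypergraphs H, H' with equal weighted projections. Equality of weights enters only through the set
  of pairs of positive weight.\<close>

locale same_pair_cover =
  fixes A B :: "'a set set" and d :: nat
  assumes d_ge: "d \<ge> 3"
    and finite_A: "finite A"
    and card_A: "h \<in> A \<Longrightarrow> card h = d"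
    and card_B: "b \<in> B \<Longrightarrow> card b = d"
    and disjoint: "A \<inter> B = {}"
    and covers: "x \<noteq> y \<Longrightarrow> (\<exists>h\<in>A. x \<in> h \<and> y \<in> h) \<longleftrightarrow> (\<exists>b\<in>B. x \<in> b \<and> y \<in> b)"
begin

lemma finite_edge: "h \<in> A \<union> B \<Longrightarrow> finite h"
  using card_A card_B d_ge by (metis UnE card.infinite not_numeral_le_zero)

lemma finite_Union: "S \<subseteq> A \<Longrightarrow> finite (\<Union>S)"
  using finite_A finite_edge by (metis UnI1 finite_Union finite_subset subsetD)

text \<open>The new hyperedge brings at most d - 2 new vertices and is charged d - 1 - \<delta>
  \<ge> d - 2.\<close>

lemma excess_insert_le:
  assumes "S \<subseteq> A" "h \<in> A - S" "card (h \<inter> \<Union>S) \<ge> 2" "\<delta> \<le> 1"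
  shows "excess d \<delta> (insert h S) \<le> excess d \<delta> S"
proof -
  have fh: "finite h" using assms finite_edge by blast
  have fS: "finite S" using assms finite_A finite_subset by blast
  have "card (h \<union> \<Union>S) + card (h \<inter> \<Union>S) = d + card (\<Union>S)"
    using card_Un_Int[OF fh finite_Union[OF assms(1)]] card_A assms by simp
  then have "real (card (\<Union>(insert h S))) + real (card (h \<inter> \<Union>S)) = real d + real (card (\<Union>S))"
    by (metis Union_insert of_nat_add)
  moreover have "card (insert h S) = Suc (card S)" using assms fS by simp
  moreover have "real (card (h \<inter> \<Union>S)) \<ge> 2" using assms by simp
  ultimately show ?thesis using assms(4) by (simp add: excess_def algebra_simps)
qed

text \<open>Let X be the part of \<open>b\<close> outside \<open>\<Union>S\<close>, and let T
  contain a hyperedge of \<open>A\<close> for every pair in \<open>b\<close> that meets X. The new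
  vertices lie in X or in h - b for some h in T, so there are at most |X| plus the sum of d - |h
  \<inter> b|. By \<open>cover_gain_ge\<close>, |X| is at most the sum of |h \<inter> b| - 1 -
  \<delta>, and the total is at most (d - 1 - \<delta>) |T|. Since no hyperedge of
  \<open>A - S\<close> meets \<open>\<Union>S\<close> twice, each h meets the old part of
  \<open>b\<close> at most once, as that lemma requires.\<close>

lemma excess_cover_le:
  assumes S: "S \<subseteq> A" and ind: "\<And>h. h \<in> A - S \<Longrightarrow> card (h \<inter> \<Union>S) \<le> 1"
    and b: "b \<in> B" "card (b \<inter> \<Union>S) \<ge> 2" "\<not> b \<subseteq> \<Union>S"
    and \<delta>: "0 \<le> \<delta>" "\<delta> * (real d + 1) < real d - 1"
  shows "\<exists>T\<subseteq>A - S. T \<noteq> {} \<and> card T \<le> d * d \<and> excess d \<delta> (S \<union> T) \<le> excess d \<delta> S"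
proof -
  define U X where "U = b \<inter> \<Union>S" and "X = b - \<Union>S"
  have fb: "finite b" using b finite_edge by blast
  have UX: "U \<union> X = b" "U \<inter> X = {}" "finite U" "finite X" using fb by (auto simp: U_def X_def)
  have cUX: "card U + card X = d" using card_Un_disjoint[of U X] UX card_B b by simp
  define pick where "pick = (\<lambda>(x, y). SOME h. h \<in> A \<and> x \<in> h \<and> y \<in> h)"
  \<comment> \<open>The pairs are ordered, which gives the bound d * d on |T|. Their first entry
    avoids \<open>\<Union>S\<close>, so every picked hyperedge is outside \<open>S\<close>.\<close>
  define P where "P = {(x, y). x \<in> X \<and> y \<in> b \<and> x \<noteq> y}"
  have pick: "pick (x, y) \<in> A \<and> x \<in> pick (x, y) \<and> y \<in> pick (x, y)" if "(x, y) \<in> P" for x y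
  proof -
    have "\<exists>h\<in>A. x \<in> h \<and> y \<in> h" using covers[of x y] that b by (auto simp: P_def X_def)
    then have "\<exists>h. h \<in> A \<and> x \<in> h \<and> y \<in> h" by blast
    from someI_ex[OF this] show ?thesis by (simp add: pick_def)
  qed
  define T where "T = pick ` P"
  have P_sub: "P \<subseteq> b \<times> b" by (auto simp: P_def X_def)
  then have fP: "finite P" using fb finite_subset by blast
  then have fT: "finite T" by (simp add: T_def)
  have "card T \<le> card P" using fP by (simp add: T_def card_image_le)
  also have "\<dots> \<le> card (b \<times> b)" using fb P_sub by (intro card_mono) auto
  finally have cT: "card T \<le> d * d" using card_B b by (simp add: card_cartesian_product)
  have TE: "\<exists>x y. x \<in> X \<and> y \<in> b \<and> x \<noteq> y \<and> x \<in> h \<and> y \<in> h \<and> h \<in> A" if "h \<in> T" for h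
    using that pick by (fastforce simp: T_def P_def)
  have TA: "T \<subseteq> A - S" using TE by (fastforce simp: X_def)
  obtain x where x: "x \<in> X" using b by (auto simp: X_def)
  obtain y where y: "y \<in> U" using b by (metis U_def card.empty equals0I not_numeral_le_zero)
  have "(x, y) \<in> P" using x y by (auto simp: P_def U_def X_def)
  then have T0: "T \<noteq> {}" by (auto simp: T_def)
  have gain: "real (card X) \<le> (\<Sum>h\<in>T. real (card (h \<inter> (U \<union> X))) - 1 - \<delta>)"
  proof (rule cover_gain_ge)
    show "\<delta> * (real (card U + card X) + 1) < real (card U + card X) - 1" using \<delta> cUX by simp
    show "2 \<le> card U" using b by (simp add: U_def)
    fix h assume h: "h \<in> T"
    then have fh: "finite h" using TA finite_edge by blast
    have "card (h \<inter> U) \<le> card (h \<inter> \<Union>S)" using fh by (intro card_mono) (auto simp: U_def)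
    then show "card (h \<inter> U) \<le> 1" using ind[of h] TA h by fastforce
    obtain x y where xy: "x \<in> X" "y \<in> b" "x \<noteq> y" "x \<in> h" "y \<in> h" using TE[OF h] by blast
    have "card {x} \<le> card (h \<inter> X)" using xy UX by (intro card_mono) auto
    then show "1 \<le> card (h \<inter> X)" by simp
    have "card {x, y} \<le> card (h \<inter> (U \<union> X))" using xy UX by (intro card_mono) auto
    then show "2 \<le> card (h \<inter> (U \<union> X))" using xy by simp
  next
    fix x y assume "x \<in> X" "y \<in> U \<union> X" "x \<noteq> y"
    then have P: "(x, y) \<in> P" using UX by (auto simp: P_def)
    then show "\<exists>h\<in>T. x \<in> h \<and> y \<in> h" using pick[OF P] by (auto simp: T_def)
  qed (use UX fT \<delta> in auto)
  have sz: "real (card (h - b)) = real d - real (card (h \<inter> b))" if "h \<in> T" for h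
  proof -
    have "h \<in> A" using that TA by blast
    then have "finite h" "card h = d" using finite_edge card_A by auto
    moreover from this have "card (h \<inter> b) \<le> d" by (metis Int_lower1 card_mono)
    ultimately show ?thesis by (simp add: card_Diff_subset_Int)
  qed
  have "\<Union>(S \<union> T) \<subseteq> \<Union>S \<union> X \<union> (\<Union>h\<in>T. h - b)" by (auto simp: X_def)
  then have "card (\<Union>(S \<union> T)) \<le> card (\<Union>S \<union> X \<union> (\<Union>h\<in>T. h - b))"
    using finite_Union[OF S] finite_Union[of T] UX TA by (intro card_mono) auto
  also have "\<dots> \<le> card (\<Union>S) + card X + card (\<Union>h\<in>T. h - b)"
    by (meson add_le_mono card_Un_le le_trans order_refl)
  also have "\<dots> \<le> card (\<Union>S) + card X + (\<Sum>h\<in>T. card (h - b))"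
    using fT by (intro add_mono card_UN_le) auto
  finally have "real (card (\<Union>(S \<union> T)))
      \<le> real (card (\<Union>S)) + real (card X) + (\<Sum>h\<in>T. real (card (h - b)))"
    by (metis of_nat_le_iff of_nat_add of_nat_sum)
  also have "(\<Sum>h\<in>T. real (card (h - b))) = (\<Sum>h\<in>T. real d - real (card (h \<inter> b)))"
    by (intro sum.cong refl sz)
  also have "real (card (\<Union>S)) + real (card X) + \<dots>
      \<le> real (card (\<Union>S)) + (\<Sum>h\<in>T. real (card (h \<inter> b)) - 1 - \<delta>) + (\<Sum>h\<in>T. real d - real (card (h \<inter> b)))"
    using gain UX by simp
  also have "\<dots> = real (card (\<Union>S)) + (\<Sum>h\<in>T. real d - 1 - \<delta>)"
    by (simp add: sum.distrib sum_subtractf algebra_simps)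
  finally have le: "real (card (\<Union>(S \<union> T))) \<le> real (card (\<Union>S)) + real (card T) * (real d - 1 - \<delta>)"
    by simp
  have "card (S \<union> T) = card S + card T"
    using TA fT S finite_A finite_subset by (intro card_Un_disjoint) auto
  then have "excess d \<delta> (S \<union> T) \<le> excess d \<delta> S"
    using le by (simp add: excess_def algebra_simps)
  with TA T0 cT show ?thesis by blast
qed

text \<open>A closed subfamily has minimum degree at least 2.\<close>

lemma excess_closed_neg:
  assumes S: "S \<subseteq> A" "S \<noteq> {}" and ind: "\<And>h. h \<in> A - S \<Longrightarrow> card (h \<inter> \<Union>S) \<le> 1"
    and cl: "\<And>b. b \<in> B \<Longrightarrow> card (b \<inter> \<Union>S) \<ge> 2 \<Longrightarrow> b \<subseteq> \<Union>S"
    and \<delta>: "\<delta> * (real d + 1) < real d - 1"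
  shows "excess d \<delta> S < 0"
proof -
  have fS: "finite S" using S finite_A finite_subset by blast
  have two: "card T \<ge> 2" if "x \<in> T" "y \<in> T" "x \<noteq> y" "finite T" for x y and T :: "'b set"
    using that by (metis card_2_iff card_mono empty_subsetI insert_subset)
  \<comment> \<open>From x in h \<in> S pass to some b \<in> B through x and another vertex of h;
    closure puts b inside \<open>\<Union>S\<close>. As b differs from h and has the same size, it
    has a vertex z outside h. A hyperedge of \<open>A\<close> through x and z meets
    \<open>\<Union>S\<close> twice, hence is in \<open>S\<close>, and it is not h.\<close>
  have deg: "card {h\<in>S. x \<in> h} \<ge> 2" if x: "x \<in> \<Union>S" for x
  proof -
    obtain h where h: "h \<in> S" "x \<in> h" using x by blast
    have ch: "card h = d" and fh: "finite h" using h S card_A finite_edge by auto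
    have "h \<noteq> {x}" using ch d_ge by auto
    then obtain y where y: "y \<in> h" "y \<noteq> x" using h by blast
    obtain b where b: "b \<in> B" "x \<in> b" "y \<in> b" using covers[of x y] y h S by blast
    have fb: "finite b" using b finite_edge by blast
    have "card (b \<inter> \<Union>S) \<ge> 2" using b y h fb by (intro two[of x _ y]) auto
    then have bS: "b \<subseteq> \<Union>S" using cl b by blast
    have "b \<noteq> h" using b h S disjoint by blast
    then obtain z where z: "z \<in> b" "z \<notin> h"
      using card_subset_eq[OF fh] ch card_B[OF b(1)] by blast
    have "x \<noteq> z" using z h by blast
    then obtain h' where h': "h' \<in> A" "x \<in> h'" "z \<in> h'" using covers[of x z] z b by blast
    have "card (h' \<inter> \<Union>S) \<ge> 2"
      using h' x z bS \<open>x \<noteq> z\<close> finite_edge by (intro two[of x _ z]) auto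
    then have "h' \<in> S" using ind[of h'] h' by fastforce
    then show ?thesis using h h' z fS by (intro two[of h _ h']) auto
  qed
  have "2 * card (\<Union>S) = (\<Sum>x\<in>\<Union>S. 2)" by simp
  also have "\<dots> \<le> (\<Sum>x\<in>\<Union>S. \<Sum>h\<in>{h\<in>S. x \<in> h}. 1)" using deg by (intro sum_mono) simp
  also have "\<dots> = (\<Sum>h\<in>S. \<Sum>x\<in>{x\<in>\<Union>S. x \<in> h}. 1)"
    using fS finite_Union[OF S(1)] by (intro sum.swap_restrict) auto
  also have "\<dots> = (\<Sum>h\<in>S. d)"
  proof (intro sum.cong refl)
    fix h assume "h \<in> S"
    moreover from this have "{x\<in>\<Union>S. x \<in> h} = h" by blast
    ultimately show "(\<Sum>x\<in>{x\<in>\<Union>S. x \<in> h}. 1) = d" using card_A S by auto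
  qed
  finally have "2 * card (\<Union>S) \<le> d * card S" by (simp add: mult.commute)
  then have v: "2 * real (card (\<Union>S)) \<le> real d * real (card S)"
    by (metis of_nat_le_iff of_nat_mult of_nat_numeral)
  \<comment> \<open>With 2 |\<open>\<Union>S\<close>| \<le> d |S|, negativity reduces to 2 + 2
    \<delta> < d. The threshold gives (2 + 2 \<delta>) (d + 1) < 4 d, and 4 d \<le> d (d + 1)
    because d \<ge> 3.\<close>
  have "(2 + 2 * \<delta>) * (real d + 1) < 2 * (real d + 1) + 2 * (real d - 1)"
    using \<delta> by (simp add: algebra_simps)
  also have "\<dots> \<le> real d * (real d + 1)"
    using mult_right_mono[of 3 "real d" "real d"] d_ge by (simp add: algebra_simps)
  finally have lt: "2 + 2 * \<delta> < real d" by (simp add: mult_less_cancel_right)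
  have "card S > 0" using S fS by (simp add: card_gt_0_iff)
  then have "(2 + 2 * \<delta>) * real (card S) < real d * real (card S)" using lt by simp
  then show ?thesis using v by (simp add: excess_def algebra_simps)
qed

text \<open>Induction over the rounds: each adds between 1 and d * d hyperedges without raising the
  excess, which starts at 1 + \<delta>. If neither kind of step is available, the family is closed
  and its excess is already negative.\<close>

lemma grow_subfamily:
  assumes "A \<noteq> {}" and \<delta>: "0 \<le> \<delta>" "\<delta> * (real d + 1) < real d - 1"
  shows "\<exists>S\<subseteq>A. S \<noteq> {} \<and> card S \<le> k * (d * d) + 1 \<and> (excess d \<delta> S < 0 \<or> k \<le> card S)
           \<and> excess d \<delta> S \<le> 1 + \<delta>"
proof (induction k)
  case 0
  obtain h where "h \<in> A" using assms by blast
  then show ?case using card_A by (intro exI[of _ "{h}"]) (auto simp: excess_singleton)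
next
  case (Suc k)
  then obtain S where S: "S \<subseteq> A" "S \<noteq> {}" "card S \<le> k * (d * d) + 1"
      "excess d \<delta> S < 0 \<or> k \<le> card S" "excess d \<delta> S \<le> 1 + \<delta>" by blast
  have fS: "finite S" using S finite_A finite_subset by blast
  have d1: "\<delta> \<le> 1"
  proof (rule ccontr)
    assume "\<not> \<delta> \<le> 1"
    then have "1 * (real d + 1) \<le> \<delta> * (real d + 1)" by (intro mult_right_mono) auto
    with \<delta>(2) show False by (smt (verit))
  qed
  show ?case
  proof (cases "excess d \<delta> S < 0")
    case True
    with S show ?thesis by (intro exI[of _ S]) auto
  next
    case False
    have "\<exists>T\<subseteq>A - S. T \<noteq> {} \<and> card T \<le> d * d \<and> excess d \<delta> (S \<union> T) \<le> excess d \<delta> S"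
    proof (cases "\<exists>h\<in>A - S. card (h \<inter> \<Union>S) \<ge> 2")
      case True
      then obtain h where h: "h \<in> A - S" "card (h \<inter> \<Union>S) \<ge> 2" by blast
      then show ?thesis using excess_insert_le[OF S(1) h d1] d_ge
        by (intro exI[of _ "{h}"]) auto
    next
      case nex: False
      then have ind: "\<And>h. h \<in> A - S \<Longrightarrow> card (h \<inter> \<Union>S) \<le> 1"
        by (metis One_nat_def Suc_1 not_less_eq_eq)
      obtain b where "b \<in> B" "card (b \<inter> \<Union>S) \<ge> 2" "\<not> b \<subseteq> \<Union>S"
        using excess_closed_neg[OF S(1,2) ind _ \<delta>(2)] False by blast
      from excess_cover_le[OF S(1) ind this \<delta>] show ?thesis .
    qed
    then obtain T where T: "T \<subseteq> A - S" "T \<noteq> {}" "card T \<le> d * d"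
        "excess d \<delta> (S \<union> T) \<le> excess d \<delta> S" by blast
    have fT: "finite T" using T finite_A finite_subset by blast
    have c: "card (S \<union> T) = card S + card T" using T fS fT by (intro card_Un_disjoint) auto
    have "card T \<ge> 1" using T fT by (simp add: Suc_le_eq card_gt_0_iff)
    with c T S False show ?thesis by (intro exI[of _ "S \<union> T"]) auto
  qed
qed

text \<open>Grow with \<delta>' and evaluate with \<delta>: once there are k hyperedges, the shift
  costs more than the initial 1 + \<delta>'. The size bound does not depend on the number of
  vertices, which the union bound later relies on.\<close>

lemma exists_negative_excess:
  assumes "A \<noteq> {}" "0 \<le> \<delta>'" "\<delta>' * (real d + 1) < real d - 1"
    and "\<delta> < \<delta>'" "1 + \<delta>' < (\<delta>' - \<delta>) * real k"
  shows "\<exists>S\<subseteq>A. S \<noteq> {} \<and> card S \<le> k * (d * d) + 1 \<and> excess d \<delta> S < 0"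
proof -
  obtain S where S: "S \<subseteq> A" "S \<noteq> {}" "card S \<le> k * (d * d) + 1"
      "excess d \<delta>' S < 0 \<or> k \<le> card S" "excess d \<delta>' S \<le> 1 + \<delta>'"
    using grow_subfamily[OF assms(1-3)] by blast
  have "excess d \<delta> S < 0"
  proof (cases "excess d \<delta>' S < 0")
    case True
    moreover have "(\<delta>' - \<delta>) * real (card S) \<ge> 0" using assms by simp
    ultimately show ?thesis using excess_shift[of d \<delta> S \<delta>'] by linarith
  next
    case False
    then have "(\<delta>' - \<delta>) * real k \<le> (\<delta>' - \<delta>) * real (card S)"
      using S assms by (intro mult_left_mono) auto
    then show ?thesis using excess_shift[of d \<delta> S \<delta>'] S assms by linarith
  qed
  with S show ?thesis by blast
qed

end

section \<open>Bounds on the recovery probability\<close>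

lemma finite_hypergraphs: "finite (hypergraphs n d)"
  by (simp add: hypergraphs_def finite_imp_finite_nsets)

lemma hypergraph_finite: "H \<in> hypergraphs n d \<Longrightarrow> finite H"
  by (auto simp: hypergraphs_def intro: finite_subset finite_imp_finite_nsets)

lemma set_random_hypergraph: "set_pmf (random_hypergraph n d p) \<subseteq> hypergraphs n d"
  by (auto simp: random_hypergraph_def hypergraphs_def)

lemma prob_subset_random_hypergraph:
  assumes "0 \<le> p" "p \<le> 1" "S \<in> hypergraphs n d"
  shows "measure_pmf.prob (random_hypergraph n d p) {H. S \<subseteq> H} = p ^ card S"
proof -
  let ?E = "nsets {1..n} d"
  have fE: "finite ?E" by (simp add: finite_imp_finite_nsets)
  have SE: "S \<subseteq> ?E" using assms by (simp add: hypergraphs_def)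
  have "(\<lambda>f. {h \<in> ?E. f h}) -` {H. S \<subseteq> H} = Pi ?E (\<lambda>h. if h \<in> S then {True} else UNIV)"
    using SE by (auto simp: Pi_def split: if_splits)
  then have "measure_pmf.prob (random_hypergraph n d p) {H. S \<subseteq> H}
      = (\<Prod>h\<in>?E. measure_pmf.prob (bernoulli_pmf p) (if h \<in> S then {True} else UNIV))"
    using fE by (simp add: random_hypergraph_def measure_Pi_pmf_Pi)
  also have "\<dots> = (\<Prod>h\<in>?E. if h \<in> S then p else 1)"
    using assms by (intro prod.cong) (auto simp: measure_pmf_single)
  also have "\<dots> = p ^ card S"
    using SE fE by (simp add: prod.If_cases Int_absorb1)
  finally show ?thesis .
qed

lemma pmf_random_hypergraph_le:
  assumes "0 \<le> p" "p \<le> 1" "H \<in> hypergraphs n d"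
  shows "pmf (random_hypergraph n d p) H \<le> p ^ card H"
proof -
  have "pmf (random_hypergraph n d p) H = measure_pmf.prob (random_hypergraph n d p) {H}"
    by (simp add: measure_pmf_single)
  also have "\<dots> \<le> measure_pmf.prob (random_hypergraph n d p) {H'. H \<subseteq> H'}"
    by (intro measure_pmf.finite_measure_mono) auto
  finally show ?thesis using prob_subset_random_hypergraph[OF assms] by simp
qed

lemma expectation_power_card_random_hypergraph:
  fixes r :: real
  assumes "0 \<le> p" "p \<le> 1" "0 \<le> r"
  shows "measure_pmf.expectation (random_hypergraph n d p) (\<lambda>H. r ^ card H)
           = (1 - p + p * r) ^ (n choose d)"
proof -
  let ?E = "nsets {1..n} d"
  have fE: "finite ?E" by (simp add: finite_imp_finite_nsets)
  have eq: "r ^ card {h \<in> ?E. f h} = (\<Prod>h\<in>?E. if f h then r else 1)" for f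
    using fE by (simp add: prod.If_cases Int_def)
  have "measure_pmf.expectation (random_hypergraph n d p) (\<lambda>H. r ^ card H)
      = measure_pmf.expectation (Pi_pmf ?E False (\<lambda>_. bernoulli_pmf p))
          (\<lambda>f. \<Prod>h\<in>?E. if f h then r else 1)"
    by (simp only: random_hypergraph_def integral_map_pmf eq)
  also have "\<dots> = (\<Prod>h\<in>?E. measure_pmf.expectation (bernoulli_pmf p) (\<lambda>v. if v then r else 1))"
    using fE assms by (intro expectation_prod_Pi_pmf) (auto intro: integrable_measure_pmf_finite)
  also have "\<dots> = (1 - p + p * r) ^ (n choose d)"
    using assms by (simp add: algebra_simps)
  finally show ?thesis .
qed

text \<open>A Chernoff bound with parameter -1: the mean of exp (- |H|) is at most exp (- L / 2),
  since 1 - p + p / e \<le> exp (- p / 2), and the cutoff L / 4 costs a factor exp (L / 4).\<close>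

lemma random_hypergraph_lower_tail:
  fixes n d :: nat and p :: real
  assumes "0 \<le> p" "p \<le> 1"
  defines "L \<equiv> real (n choose d) * p"
  shows "measure_pmf.prob (random_hypergraph n d p) {H. real (card H) < L / 4} \<le> exp (- L / 4)"
proof -
  let ?M = "random_hypergraph n d p"
  have int: "integrable (measure_pmf ?M) f" for f :: "_ \<Rightarrow> real"
    by (rule integrable_measure_pmf_finite)
      (rule finite_subset[OF set_random_hypergraph finite_hypergraphs])
  have "measure_pmf.prob ?M {H. real (card H) < L / 4}
      = measure_pmf.expectation ?M (indicator {H. real (card H) < L / 4})" by simp
  also have "\<dots> \<le> measure_pmf.expectation ?M (\<lambda>H. exp (L / 4) * exp (- 1) ^ card H)"
  proof (rule integral_mono[OF int int])
    fix H
    have "exp (L / 4) * exp (- 1) ^ card H = exp (L / 4 - real (card H))"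
      by (simp add: exp_of_nat_mult[symmetric] exp_add[symmetric])
    then show "indicator {H. real (card H) < L / 4} H \<le> exp (L / 4) * exp (- 1) ^ card H"
      by (auto simp: indicator_def)
  qed
  also have "\<dots> = exp (L / 4) * (1 - p + p * exp (- 1)) ^ (n choose d)"
    using expectation_power_card_random_hypergraph[OF assms(1,2), of "exp (- 1)"] by simp
  also have "\<dots> \<le> exp (L / 4) * exp (- p / 2) ^ (n choose d)"
  proof (intro mult_left_mono power_mono)
    have "exp (- 1 :: real) \<le> 1 / 2"
      using exp_ge_add_one_self[of "1 :: real"] by (simp add: exp_minus field_simps)
    then have "p * exp (- 1) \<le> p * (1 / 2)" using assms by (intro mult_left_mono) auto
    then have "1 - p + p * exp (- 1) \<le> 1 + (- p / 2)" by simp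
    also have "\<dots> \<le> exp (- p / 2)" by (rule exp_ge_add_one_self)
    finally show "1 - p + p * exp (- 1) \<le> exp (- p / 2)" .
  qed (use assms in auto)
  also have "\<dots> = exp (- L / 4)"
    by (simp add: exp_of_nat_mult[symmetric] exp_add[symmetric] L_def)
  finally show ?thesis .
qed

section \<open>Upper bound by summing over weight functions\<close>

lemma sum_weighted_proj:
  assumes "H \<in> hypergraphs n d"
  shows "(\<Sum>e\<in>nsets {1..n} 2. weighted_proj n H e) = (d choose 2) * card H"
proof -
  let ?E = "nsets {1..n} 2"
  have fE: "finite ?E" by (simp add: finite_imp_finite_nsets)
  have fH: "finite H" using assms by (rule hypergraph_finite)
  have "(\<Sum>e\<in>?E. weighted_proj n H e) = (\<Sum>e\<in>?E. \<Sum>h\<in>{h\<in>H. e \<subseteq> h}. 1)"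
    by (intro sum.cong) (auto simp: weighted_proj_def)
  also have "\<dots> = (\<Sum>h\<in>H. \<Sum>e\<in>{e\<in>?E. e \<subseteq> h}. 1)"
    using fE fH by (intro sum.swap_restrict) auto
  also have "\<dots> = (\<Sum>h\<in>H. d choose 2)"
  proof (intro sum.cong refl)
    fix h assume "h \<in> H"
    then have h: "h \<subseteq> {1..n}" "finite h" "card h = d"
      using assms by (auto simp: hypergraphs_def nsets_def)
    then have "{e\<in>?E. e \<subseteq> h} = nsets h 2" by (auto simp: nsets_def)
    then show "(\<Sum>e\<in>{e\<in>?E. e \<subseteq> h}. 1) = d choose 2" using h by simp
  qed
  finally show ?thesis by simp
qed

text \<open>The exponent is the total projected weight, and the projection is injective on
  \<open>R\<close>. So the sum is at most the sum of t to the total weight over all weight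
  functions, a product of one geometric series per pair.\<close>

lemma sum_power_recovered_le:
  fixes t :: real
  assumes t: "0 < t" "t < 1" and R: "R \<subseteq> hypergraphs n d" "\<And>H. H \<in> R \<Longrightarrow> A (weighted_proj n H) = H"
  shows "(\<Sum>H\<in>R. t ^ ((d choose 2) * card H)) \<le> (1 / (1 - t)) ^ (n choose 2)"
proof -
  \<comment> \<open>\<open>?K\<close> caps every weight, so the enlarged set of weight functions is
    still finite.\<close>
  let ?E = "nsets {1..n} 2" and ?K = "card (nsets {1..n} d)"
  let ?g = "\<lambda>H. restrict (weighted_proj n H) ?E"
  have fE: "finite ?E" by (simp add: finite_imp_finite_nsets)
  have inj: "inj_on ?g R"
  proof (rule inj_onI)
    fix H H' assume H: "H \<in> R" "H' \<in> R" "?g H = ?g H'"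
    have "weighted_proj n H e = weighted_proj n H' e" for e
      using fun_cong[OF H(3), of e] by (cases "e \<in> ?E") (auto simp: weighted_proj_def)
    then have "weighted_proj n H = weighted_proj n H'" by blast
    then show "H = H'" using R(2) H(1,2) by metis
  qed
  have "(\<Sum>H\<in>R. t ^ ((d choose 2) * card H)) = (\<Sum>H\<in>R. \<Prod>e\<in>?E. t ^ ?g H e)"
  proof (intro sum.cong refl)
    fix H assume "H \<in> R"
    then have "t ^ ((d choose 2) * card H) = t ^ (\<Sum>e\<in>?E. weighted_proj n H e)"
      using R sum_weighted_proj by (metis subsetD)
    then show "t ^ ((d choose 2) * card H) = (\<Prod>e\<in>?E. t ^ ?g H e)"
      by (simp add: power_sum)
  qed
  also have "\<dots> = (\<Sum>g\<in>?g ` R. \<Prod>e\<in>?E. t ^ g e)"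
    by (simp only: sum.reindex[OF inj] comp_def)
  also have "\<dots> \<le> (\<Sum>g\<in>PiE ?E (\<lambda>_. {..?K}). \<Prod>e\<in>?E. t ^ g e)"
  proof (rule sum_mono2)
    show "?g ` R \<subseteq> PiE ?E (\<lambda>_. {..?K})"
    proof (rule image_subsetI, rule restrict_PiE_iff[THEN iffD2], rule ballI, unfold atMost_iff)
      fix H e assume "H \<in> R"
      then have H: "H \<subseteq> nsets {1..n} d" using R by (auto simp: hypergraphs_def)
      have "card {h \<in> H. e \<subseteq> h} \<le> ?K"
        using H by (intro card_mono finite_imp_finite_nsets) auto
      then show "weighted_proj n H e \<le> ?K" by (simp add: weighted_proj_def del: card_nsets)
    qed
  qed (use fE t in \<open>auto intro!: finite_PiE prod_nonneg\<close>)
  also have "\<dots> = (\<Prod>e\<in>?E. \<Sum>k\<le>?K. t ^ k)"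
    using fE by (intro prod_sum_PiE[symmetric]) auto
  also have "\<dots> \<le> (\<Prod>e\<in>?E. 1 / (1 - t))"
  proof (rule prod_mono, safe)
    show "0 \<le> (\<Sum>k\<le>?K. t ^ k)" using t by (intro sum_nonneg) auto
    have "(\<Sum>k\<le>?K. t ^ k) \<le> (\<Sum>k. t ^ k)"
      using t by (intro sum_le_suminf summable_geometric) auto
    then show "(\<Sum>k\<le>?K. t ^ k) \<le> 1 / (1 - t)" using t by (simp add: suminf_geometric)
  qed
  also have "\<dots> = (1 / (1 - t)) ^ (n choose 2)" by simp
  finally show ?thesis .
qed

text \<open>The lower tail bound handles hypergraphs with fewer than L / 4 edges. For m edges write
  p ^ m as q ^ m times t ^ (C m) with q = p / t ^ C \<le> 1: for m \<ge> L / 4 the first factor is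
  at most q powr (L / 4), and the second is summed over the recovered hypergraphs.\<close>

lemma weighted_recovery_prob_le:
  fixes n d :: nat and p t :: real
  assumes p: "0 < p" "p \<le> 1" and t: "0 < t" "t < 1" and pt: "p \<le> t ^ (d choose 2)"
  defines "L \<equiv> real (n choose d) * p"
  shows "weighted_recovery_prob n d p
    \<le> exp (- L / 4) + (p / t ^ (d choose 2)) powr (L / 4) * (1 / (1 - t)) ^ (n choose 2)"
  unfolding weighted_recovery_prob_def
proof (rule Max.boundedI)
  show "finite ((\<lambda>A. measure_pmf.prob (random_hypergraph n d p) {H. A (weighted_proj n H) = H})
          ` recovery_maps n d)"
    using finite_recovery_maps by blast
  show "(\<lambda>A. measure_pmf.prob (random_hypergraph n d p) {H. A (weighted_proj n H) = H})
          ` recovery_maps n d \<noteq> {}"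
    using recovery_maps_nonempty by blast
next
  let ?M = "random_hypergraph n d p"
  fix x assume "x \<in> (\<lambda>A. measure_pmf.prob ?M {H. A (weighted_proj n H) = H}) ` recovery_maps n d"
  then obtain A where x: "x = measure_pmf.prob ?M {H. A (weighted_proj n H) = H}" by blast
  define C where "C = d choose 2"
  define q where "q = p / t ^ C"
  have q: "0 < q" "q \<le> 1" using p t pt by (auto simp: q_def C_def)
  define R where "R = {H \<in> hypergraphs n d. A (weighted_proj n H) = H \<and> L / 4 \<le> real (card H)}"
  have fR: "finite R" using finite_hypergraphs by (auto simp: R_def)
  have "x \<le> measure_pmf.prob ?M ({H. real (card H) < L / 4} \<union> R)"
    unfolding x using set_random_hypergraph[of n d p]
    by (intro measure_pmf.finite_measure_mono_AE) (auto simp: R_def AE_measure_pmf_iff not_less)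
  also have "\<dots> \<le> measure_pmf.prob ?M {H. real (card H) < L / 4} + measure_pmf.prob ?M R"
    by (intro measure_Un_le) auto
  also have "\<dots> \<le> exp (- L / 4) + measure_pmf.prob ?M R"
    using random_hypergraph_lower_tail[of p n d] p by (simp add: L_def)
  also have "measure_pmf.prob ?M R = (\<Sum>H\<in>R. pmf ?M H)"
    using fR by (rule measure_measure_pmf_finite)
  also have "\<dots> \<le> (\<Sum>H\<in>R. q powr (L / 4) * t ^ (C * card H))"
  proof (rule sum_mono)
    fix H assume H: "H \<in> R"
    have "pmf ?M H \<le> p ^ card H"
      using H p by (intro pmf_random_hypergraph_le) (auto simp: R_def)
    also have "p ^ card H = q powr real (card H) * t ^ (C * card H)"
      using t q by (simp add: powr_realpow q_def power_divide power_mult)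
    also have "\<dots> \<le> q powr (L / 4) * t ^ (C * card H)"
      using H q t by (intro mult_right_mono powr_mono') (auto simp: R_def)
    finally show "pmf ?M H \<le> q powr (L / 4) * t ^ (C * card H)" .
  qed
  also have "\<dots> = q powr (L / 4) * (\<Sum>H\<in>R. t ^ (C * card H))"
    by (simp add: sum_distrib_left)
  also have "\<dots> \<le> q powr (L / 4) * (1 / (1 - t)) ^ (n choose 2)"
    unfolding C_def using t
    by (intro mult_left_mono sum_power_recovered_le[of t R n d A]) (auto simp: R_def)
  finally show "x \<le> exp (- L / 4) + (p / t ^ (d choose 2)) powr (L / 4) * (1 / (1 - t)) ^ (n choose 2)"
    by (simp add: q_def C_def)
qed

section \<open>Lower bound by the first moment method\<close>

text \<open>Common hyperedges contribute equally to both projections, so each pair lies in equally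
  many hyperedges of the two differences.\<close>

lemma same_pair_cover_Diff:
  assumes "d \<ge> 3" and H: "H \<in> hypergraphs n d" "H' \<in> hypergraphs n d"
    and eq: "weighted_proj n H = weighted_proj n H'"
  shows "same_pair_cover (H - H') (H' - H) d"
proof
  have fin: "finite H" "finite H'" using H hypergraph_finite by auto
  fix x y :: nat assume xy: "x \<noteq> y"
  have split: "card {h\<in>J. {x, y} \<subseteq> h} = card {h\<in>J \<inter> J'. {x, y} \<subseteq> h} + card {h\<in>J - J'. {x, y} \<subseteq> h}"
    if "finite J" for J J' :: "nat set set"
  proof -
    have "{h\<in>J. {x, y} \<subseteq> h} = {h\<in>J \<inter> J'. {x, y} \<subseteq> h} \<union> {h\<in>J - J'. {x, y} \<subseteq> h}" by blast
    moreover have "card ({h\<in>J \<inter> J'. {x, y} \<subseteq> h} \<union> {h\<in>J - J'. {x, y} \<subseteq> h})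
        = card {h\<in>J \<inter> J'. {x, y} \<subseteq> h} + card {h\<in>J - J'. {x, y} \<subseteq> h}"
      using that by (intro card_Un_disjoint) auto
    ultimately show ?thesis by simp
  qed
  show "(\<exists>h\<in>H - H'. x \<in> h \<and> y \<in> h) \<longleftrightarrow> (\<exists>b\<in>H' - H. x \<in> b \<and> y \<in> b)"
  proof (cases "x \<in> {1..n} \<and> y \<in> {1..n}")
    case True
    then have "{x, y} \<in> nsets {1..n} 2" using xy by (auto simp: nsets_def)
    then have "card {h\<in>H. {x, y} \<subseteq> h} = card {h\<in>H'. {x, y} \<subseteq> h}"
      using fun_cong[OF eq, of "{x, y}"] by (simp add: weighted_proj_def)
    then have "card {h\<in>H - H'. {x, y} \<subseteq> h} = card {h\<in>H' - H. {x, y} \<subseteq> h}"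
      using split[OF fin(1), of H'] split[OF fin(2), of H] by (simp add: Int_commute)
    moreover have fin': "finite {h\<in>H - H'. {x, y} \<subseteq> h}" "finite {h\<in>H' - H. {x, y} \<subseteq> h}"
      using fin by simp_all
    ultimately have "{h\<in>H - H'. {x, y} \<subseteq> h} = {} \<longleftrightarrow> {h\<in>H' - H. {x, y} \<subseteq> h} = {}"
      by (simp only: card_0_eq[OF fin'(1), symmetric] card_0_eq[OF fin'(2), symmetric])
    then show ?thesis unfolding Collect_empty_eq insert_subset by blast
  next
    \<comment> \<open>Here the projection only shows its dummy weight 0, but no hyperedge contains a
      vertex outside {1..n}.\<close>
    case False
    moreover have "h \<subseteq> {1..n}" if "h \<in> H \<union> H'" for h
      using H that by (auto simp: hypergraphs_def nsets_def)
    ultimately show ?thesis by blast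
  qed
qed (use assms hypergraph_finite in \<open>auto simp: hypergraphs_def nsets_def\<close>)

text \<open>Choose the vertex set, then any family of its subsets. The crude factor is harmless
  because v stays bounded in the application.\<close>

lemma card_hypergraphs_vertices_le:
  assumes "n \<ge> 1"
  shows "card {S \<in> hypergraphs n d. card (\<Union>S) = v} \<le> n ^ v * 2 ^ 2 ^ v"
proof -
  have "{S \<in> hypergraphs n d. card (\<Union>S) = v} \<subseteq> (\<Union>V\<in>nsets {1..n} v. Pow (Pow V))"
  proof
    fix S assume "S \<in> {S \<in> hypergraphs n d. card (\<Union>S) = v}"
    moreover from this have "\<Union>S \<subseteq> {1..n}" by (auto simp: hypergraphs_def nsets_def)
    ultimately have "\<Union>S \<in> nsets {1..n} v" by (auto simp: nsets_def intro: finite_subset)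
    then show "S \<in> (\<Union>V\<in>nsets {1..n} v. Pow (Pow V))" by (intro UN_I[of "\<Union>S"]) auto
  qed
  then have "card {S \<in> hypergraphs n d. card (\<Union>S) = v} \<le> card (\<Union>V\<in>nsets {1..n} v. Pow (Pow V))"
    by (intro card_mono) (auto simp: finite_imp_finite_nsets nsets_def intro: finite_subset)
  also have "\<dots> \<le> (\<Sum>V\<in>nsets {1..n} v. card (Pow (Pow V)))"
    by (intro card_UN_le finite_imp_finite_nsets) auto
  also have "\<dots> = (\<Sum>V\<in>nsets {1..n} v. 2 ^ 2 ^ v)"
    by (intro sum.cong) (auto simp: nsets_def card_Pow)
  also have "\<dots> = (n choose v) * 2 ^ 2 ^ v" by simp
  also have "\<dots> \<le> n ^ v * 2 ^ 2 ^ v"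
    by (cases "v \<le> n") (auto simp: binomial_le_pow binomial_eq_0)
  finally show ?thesis .
qed

lemma weighted_recovery_prob_le_1: "weighted_recovery_prob n d p \<le> 1"
  unfolding weighted_recovery_prob_def
  using finite_recovery_maps recovery_maps_nonempty by (intro Max.boundedI) auto

lemma weighted_recovery_prob_nonneg: "0 \<le> weighted_recovery_prob n d p"
proof -
  obtain A where "A \<in> recovery_maps n d" using recovery_maps_nonempty by blast
  then have "measure_pmf.prob (random_hypergraph n d p) {H. A (weighted_proj n H) = H}
      \<le> weighted_recovery_prob n d p"
    unfolding weighted_recovery_prob_def using finite_recovery_maps by (intro Max_ge) auto
  then show ?thesis by (meson measure_nonneg order_trans)
qed

text \<open>Any map returning a preimage of the projection does. If it answers H' \<noteq> H, then H
  - H' contains a subfamily of at most \<open>K\<close> hyperedges with negative excess; a union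
  bound over such subfamilies, sorted by their numbers m of hyperedges and v of vertices, gives the
  sum.\<close>

lemma weighted_recovery_prob_ge:
  fixes n d k :: nat and p \<delta> \<delta>' :: real
  assumes d: "d \<ge> 3" and n: "n \<ge> 1" and p: "0 \<le> p" "p \<le> 1"
    and \<delta>: "0 \<le> \<delta>'" "\<delta>' * (real d + 1) < real d - 1" "\<delta> < \<delta>'" "1 + \<delta>' < (\<delta>' - \<delta>) * real k"
  defines "K \<equiv> k * (d * d) + 1"
  shows "1 - (\<Sum>(m, v)\<in>{(m, v). m \<le> K \<and> v \<le> d * K \<and> real v < (real d - 1 - \<delta>) * real m}.
             2 ^ 2 ^ v * (real n ^ v * p ^ m)) \<le> weighted_recovery_prob n d p"
proof -
  let ?M = "random_hypergraph n d p"
  let ?I = "{(m, v). m \<le> K \<and> v \<le> d * K \<and> real v < (real d - 1 - \<delta>) * real m}"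
  have fI: "finite ?I" by (rule finite_subset[of _ "{..K} \<times> {..d * K}"]) auto
  define A where "A = restrict (inv_into (hypergraphs n d) (weighted_proj n)) (weighted_proj n ` hypergraphs n d)"
  have A: "A \<in> recovery_maps n d"
    by (auto simp: A_def recovery_maps_def intro!: inv_into_into)
  define F where "F = {S \<in> hypergraphs n d. card S \<le> K \<and> excess d \<delta> S < 0}"
  have fF: "finite F" using finite_hypergraphs by (auto simp: F_def)
  have fail: "\<exists>S\<in>F. S \<subseteq> H" if H: "H \<in> hypergraphs n d" "A (weighted_proj n H) \<noteq> H" for H
  proof -
    define H' where "H' = A (weighted_proj n H)"
    have H': "H' \<in> hypergraphs n d" "weighted_proj n H = weighted_proj n H'"
      using H by (auto simp: H'_def A_def inv_into_into f_inv_into_f)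
    interpret same_pair_cover "H - H'" "H' - H" d
      by (rule same_pair_cover_Diff[OF d H(1) H'])
    interpret B: same_pair_cover "H' - H" "H - H'" d
      by (rule same_pair_cover_Diff[OF d H'(1) H(1) H'(2)[symmetric]])
    \<comment> \<open>Otherwise H' has an extra hyperedge, and a pair inside it would have to be
      covered by the empty family.\<close>
    have "H - H' \<noteq> {}"
    proof
      assume e: "H - H' = {}"
      then obtain b where b: "b \<in> H' - H" using H by (auto simp: H'_def)
      then have "card b \<ge> 2" using d card_B by fastforce
      then have "\<not> card b \<le> Suc 0" by simp
      moreover have "finite b" using B.finite_edge b by blast
      ultimately obtain x y where "x \<in> b" "y \<in> b" "x \<noteq> y"
        by (auto simp: card_le_Suc0_iff_eq)
      then show False using covers[of x y] b e by auto
    qed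
    from exists_negative_excess[OF this \<delta>] obtain S
      where "S \<subseteq> H - H'" "card S \<le> K" "excess d \<delta> S < 0" by (auto simp: K_def)
    with H show ?thesis by (intro bexI[of _ S]) (auto simp: F_def hypergraphs_def)
  qed
  have "measure_pmf.prob ?M {H. A (weighted_proj n H) \<noteq> H} \<le> measure_pmf.prob ?M (\<Union>S\<in>F. {H. S \<subseteq> H})"
    using set_random_hypergraph[of n d p] fail
    by (intro measure_pmf.finite_measure_mono_AE) (auto simp: AE_measure_pmf_iff)
  also have "\<dots> \<le> (\<Sum>S\<in>F. measure_pmf.prob ?M {H. S \<subseteq> H})"
    using fF by (intro measure_UNION_le) auto
  also have "\<dots> = (\<Sum>S\<in>F. p ^ card S)"
    by (intro sum.cong prob_subset_random_hypergraph p) (auto simp: F_def)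
  \<comment> \<open>Negative excess says exactly that (m, v) satisfies the strict inequality
    defining \<open>?I\<close>; this index set does not depend on n.\<close>
  also have "\<dots> = (\<Sum>i\<in>?I. \<Sum>S\<in>{S \<in> F. (card S, card (\<Union>S)) = i}. p ^ card S)"
  proof (rule sum.group[symmetric, OF fF fI], safe)
    fix S assume S: "S \<in> F"
    then have fS: "finite S" using hypergraph_finite by (auto simp: F_def)
    show "card S \<le> K" using S by (simp add: F_def)
    have "card (\<Union>S) \<le> (\<Sum>h\<in>S. card h)" using card_UN_le[OF fS, of id] by simp
    also have "\<dots> = (\<Sum>h\<in>S. d)"
      using S by (intro sum.cong) (auto simp: F_def hypergraphs_def nsets_def)
    also have "\<dots> \<le> d * K" using S by (simp add: F_def)
    finally show "card (\<Union>S) \<le> d * K" .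
    show "real (card (\<Union>S)) < (real d - 1 - \<delta>) * real (card S)"
      using S by (simp add: F_def excess_def)
  qed
  also have "\<dots> \<le> (\<Sum>(m, v)\<in>?I. 2 ^ 2 ^ v * (real n ^ v * p ^ m))"
  proof (rule sum_mono, safe)
    fix m v
    let ?Q = "{S \<in> F. (card S, card (\<Union>S)) = (m, v)}"
    have "card ?Q \<le> card {S \<in> hypergraphs n d. card (\<Union>S) = v}"
      using finite_hypergraphs by (intro card_mono) (auto simp: F_def)
    also have "\<dots> \<le> n ^ v * 2 ^ 2 ^ v" by (rule card_hypergraphs_vertices_le[OF n])
    finally have "real (card ?Q) \<le> real (n ^ v * 2 ^ 2 ^ v)" by (rule of_nat_mono)
    then have c: "real (card ?Q) \<le> real n ^ v * 2 ^ 2 ^ v" by simp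
    have "(\<Sum>S\<in>?Q. p ^ card S) = real (card ?Q) * p ^ m" by simp
    also have "\<dots> \<le> (real n ^ v * 2 ^ 2 ^ v) * p ^ m" using c p by (intro mult_right_mono) auto
    finally show "(\<Sum>S\<in>?Q. p ^ card S) \<le> 2 ^ 2 ^ v * (real n ^ v * p ^ m)"
      by (simp add: mult_ac)
  qed
  finally have "measure_pmf.prob ?M {H. A (weighted_proj n H) \<noteq> H}
      \<le> (\<Sum>(m, v)\<in>?I. 2 ^ 2 ^ v * (real n ^ v * p ^ m))" .
  moreover have "measure_pmf.prob ?M {H. A (weighted_proj n H) = H}
      = 1 - measure_pmf.prob ?M {H. A (weighted_proj n H) \<noteq> H}"
  proof -
    have "UNIV - {H. A (weighted_proj n H) \<noteq> H} = {H. A (weighted_proj n H) = H}" by blast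
    then show ?thesis
      using measure_pmf.prob_compl[of "{H. A (weighted_proj n H) \<noteq> H}" ?M] by simp
  qed
  moreover have "measure_pmf.prob ?M {H. A (weighted_proj n H) = H} \<le> weighted_recovery_prob n d p"
    unfolding weighted_recovery_prob_def using finite_recovery_maps A by (intro Max_ge) auto
  ultimately show ?thesis by linarith
qed

section \<open>Asymptotics\<close>

lemma perturbed_const_tendsto:
  fixes c :: real
  assumes "\<epsilon> \<longlonglongrightarrow> 0" "e < 0"
  shows "(\<lambda>n. (c + \<epsilon> n) * real n powr e) \<longlonglongrightarrow> 0"
proof -
  have "(\<lambda>n. c + \<epsilon> n) \<longlonglongrightarrow> c + 0" by (intro tendsto_intros assms)
  moreover have "(\<lambda>n. real n powr e) \<longlonglongrightarrow> 0"
    by (rule tendsto_neg_powr[OF assms(2) filterlim_real_sequentially])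
  ultimately have "(\<lambda>n. (c + \<epsilon> n) * real n powr e) \<longlonglongrightarrow> (c + 0) * 0" by (rule tendsto_mult)
  then show ?thesis by simp
qed

lemma eventually_perturbed_const_ge:
  fixes c :: real
  assumes "c > 0" "\<epsilon> \<longlonglongrightarrow> 0"
  shows "\<forall>\<^sub>F n in sequentially. c / 2 \<le> c + \<epsilon> n"
proof -
  have "(\<lambda>n. c + \<epsilon> n) \<longlonglongrightarrow> c + 0" by (intro tendsto_intros assms)
  then have "\<forall>\<^sub>F n in sequentially. c / 2 < c + \<epsilon> n"
    using assms by (intro order_tendstoD(1)[of _ "c + 0"]) auto
  then show ?thesis by eventually_elim simp
qed

text \<open>Two exponents are inserted between \<delta> and the threshold. The gap from \<delta> to
  \<delta>' absorbs the factor c + \<epsilon> n, so that eventually p n \<le> n powr (- (d - 1 -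
  \<delta>')); the gap from \<delta>' to \<delta>'' is the loss per hyperedge during growth. Each of
  the finitely many terms is then a constant times at most a negative power of n.\<close>

lemma weighted_recovery_tendsto_1:
  fixes d :: nat and \<delta> c :: real and p \<epsilon> :: "nat \<Rightarrow> real"
  assumes d: "d \<ge> 3" and c: "c > 0" and \<epsilon>: "\<epsilon> \<longlonglongrightarrow> 0"
    and p: "\<forall>\<^sub>F n in sequentially. p n = (c + \<epsilon> n) * real n powr (- real d + 1 + \<delta>)"
    and lt: "\<delta> < (real d - 1) / (real d + 1)"
  shows "(\<lambda>n. weighted_recovery_prob n d (p n)) \<longlonglongrightarrow> 1"
proof -
  define \<theta> where "\<theta> = (real d - 1) / (real d + 1)"
  have \<theta>: "0 < \<theta>" "\<theta> < 1" using d by (auto simp: \<theta>_def)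
  \<comment> \<open>The maximum with 0 covers negative \<delta>, as the growth argument takes a
    nonnegative exponent.\<close>
  obtain \<delta>' where \<delta>': "max \<delta> 0 < \<delta>'" "\<delta>' < \<theta>"
    using dense[of "max \<delta> 0" \<theta>] lt \<theta> by (auto simp: \<theta>_def)
  obtain \<delta>'' where \<delta>'': "\<delta>' < \<delta>''" "\<delta>'' < \<theta>" using dense[OF \<delta>'(2)] by blast
  obtain k :: nat where k: "1 + \<delta>'' < (\<delta>'' - \<delta>') * real k"
    using reals_Archimedean3[of "\<delta>'' - \<delta>'"] \<delta>'' by (auto simp: mult.commute)
  have thr: "\<delta>'' * (real d + 1) < real d - 1"
    using \<delta>''(2) by (simp add: \<theta>_def pos_less_divide_eq)
  define K where "K = k * (d * d) + 1"
  define I where "I = {(m, v). m \<le> K \<and> v \<le> d * K \<and> real v < (real d - 1 - \<delta>') * real m}"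
  have fI: "finite I" unfolding I_def by (rule finite_subset[of _ "{..K} \<times> {..d * K}"]) auto
  have "(\<lambda>n. (c + \<epsilon> n) * real n powr (\<delta> - \<delta>')) \<longlonglongrightarrow> 0"
    using \<delta>' by (intro perturbed_const_tendsto \<epsilon>) auto
  then have ev1: "\<forall>\<^sub>F n in sequentially. (c + \<epsilon> n) * real n powr (\<delta> - \<delta>') < 1"
    by (rule order_tendstoD) simp
  have bounds: "\<forall>\<^sub>F n in sequentially.
      n \<ge> 1 \<and> 0 \<le> p n \<and> p n \<le> real n powr (- (real d - 1 - \<delta>')) \<and> p n \<le> 1"
    using p ev1 eventually_perturbed_const_ge[OF c \<epsilon>] eventually_ge_at_top[of 1]
  proof eventually_elim
    case (elim n)
    have "p n = (c + \<epsilon> n) * real n powr (\<delta> - \<delta>') * real n powr (- (real d - 1 - \<delta>'))"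
      using elim(1) by (simp add: mult.assoc powr_add[symmetric] algebra_simps)
    also have "\<dots> \<le> 1 * real n powr (- (real d - 1 - \<delta>'))"
      using elim(2) by (intro mult_right_mono) auto
    finally have le: "p n \<le> real n powr (- (real d - 1 - \<delta>'))" by simp
    also have "\<dots> \<le> real n powr 0" using elim(4) \<delta>' \<theta> d by (intro powr_mono) auto
    finally have "p n \<le> 1" using elim(4) by simp
    with le show ?case using elim c by simp
  qed
  have term0: "(\<lambda>n. real n ^ v * p n ^ m) \<longlonglongrightarrow> 0" if mv: "(m, v) \<in> I" for m v
  proof -
    have lim: "(\<lambda>n. real n powr (real v - (real d - 1 - \<delta>') * real m)) \<longlonglongrightarrow> 0"
      using mv by (intro tendsto_neg_powr filterlim_real_sequentially) (auto simp: I_def)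
    have lower: "\<forall>\<^sub>F n in sequentially. 0 \<le> real n ^ v * p n ^ m"
      using bounds by eventually_elim simp
    have upper: "\<forall>\<^sub>F n in sequentially.
        real n ^ v * p n ^ m \<le> real n powr (real v - (real d - 1 - \<delta>') * real m)"
      using bounds
    proof eventually_elim
      case (elim n)
      have "real n ^ v * p n ^ m \<le> real n ^ v * (real n powr (- (real d - 1 - \<delta>'))) ^ m"
        using elim by (intro mult_left_mono power_mono) auto
      also have "\<dots> = real n powr real v * real n powr (- (real d - 1 - \<delta>') * real m)"
        using elim by (simp add: powr_realpow powr_powr[symmetric])
      also have "\<dots> = real n powr (real v - (real d - 1 - \<delta>') * real m)"
        by (simp add: powr_add[symmetric] algebra_simps)
      finally show ?case .
    qed
    from tendsto_sandwich[OF lower upper tendsto_const lim] show ?thesis .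
  qed
  have "(\<lambda>n. \<Sum>(m, v)\<in>I. 2 ^ 2 ^ v * (real n ^ v * p n ^ m)) \<longlonglongrightarrow> (\<Sum>(m, v)\<in>I. 0)"
    unfolding case_prod_unfold
    by (intro tendsto_sum tendsto_mult_right_zero term0) auto
  then have "(\<lambda>n. 1 - (\<Sum>(m, v)\<in>I. 2 ^ 2 ^ v * (real n ^ v * p n ^ m))) \<longlonglongrightarrow> 1 - 0"
    by (intro tendsto_diff tendsto_const) (simp add: case_prod_unfold)
  then have lim: "(\<lambda>n. 1 - (\<Sum>(m, v)\<in>I. 2 ^ 2 ^ v * (real n ^ v * p n ^ m))) \<longlonglongrightarrow> 1" by simp
  have "\<forall>\<^sub>F n in sequentially. 1 - (\<Sum>(m, v)\<in>I. 2 ^ 2 ^ v * (real n ^ v * p n ^ m))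
      \<le> weighted_recovery_prob n d (p n)"
    using bounds
  proof eventually_elim
    case (elim n)
    then show ?case unfolding I_def K_def
      using \<delta>' \<delta>'' thr k d by (intro weighted_recovery_prob_ge) auto
  qed
  then show ?thesis
    by (rule tendsto_sandwich[OF _ _ lim tendsto_const]) (simp add: weighted_recovery_prob_le_1)
qed

text \<open>Turns the product of geometric series into an exponential of order t n ^ 2.\<close>

lemma inverse_one_minus_le_exp:
  fixes t :: real
  assumes "0 \<le> t" "t \<le> 1 / 2"
  shows "1 / (1 - t) \<le> exp (2 * t)"
proof -
  have "t * (2 * t) \<le> t * 1" using assms by (intro mult_left_mono) auto
  then have "1 \<le> (1 + 2 * t) * (1 - t)" by (simp add: algebra_simps)
  also have "\<dots> \<le> exp (2 * t) * (1 - t)"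
    using assms exp_ge_add_one_self[of "2 * t"] by (intro mult_right_mono) auto
  finally show ?thesis using assms by (simp add: pos_divide_le_eq)
qed

text \<open>The constant combines (n choose d) \<ge> (n / d) ^ d with x \<ge> c / 2.\<close>

lemma expected_edges_ge:
  fixes c :: real
  assumes "1 \<le> d" "d \<le> n" "c / 2 \<le> x" "0 < c"
  shows "c / (2 * real d ^ d) * real n powr (1 + \<delta>)
           \<le> real (n choose d) * (x * real n powr (- real d + 1 + \<delta>))"
proof -
  have n: "real n > 0" using assms by simp
  have "c / (2 * real d ^ d) * real n powr (1 + \<delta>)
      = (real n / real d) ^ d * (c / 2 * real n powr (- real d + 1 + \<delta>))"
  proof -
    have "real n ^ d * real n powr (- real d + 1 + \<delta>) = real n powr (1 + \<delta>)"
      using n by (simp add: powr_realpow[symmetric] powr_add[symmetric])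
    then show ?thesis by (simp add: power_divide mult_ac)
  qed
  also have "\<dots> \<le> real (n choose d) * (x * real n powr (- real d + 1 + \<delta>))"
    using assms binomial_ge_n_over_k_pow_k[of d n, where 'a = real]
    by (intro mult_mono) auto
  finally show ?thesis .
qed

text \<open>Choose t so that the series contribute at most exp (n powr (1 + \<delta>)), the exponent
  having the order of the expected number of edges. Above the threshold q = p / t ^ C still tends to
  0, so q powr (L / 4) outweighs this factor.\<close>

lemma weighted_recovery_tendsto_0:
  fixes d :: nat and \<delta> c :: real and p \<epsilon> :: "nat \<Rightarrow> real"
  assumes d: "d \<ge> 3" and \<delta>d: "\<delta> < real d - 1" and c: "c > 0" and \<epsilon>: "\<epsilon> \<longlonglongrightarrow> 0"
    and p: "\<forall>\<^sub>F n in sequentially. p n = (c + \<epsilon> n) * real n powr (- real d + 1 + \<delta>)"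
    and gt: "\<delta> > (real d - 1) / (real d + 1)"
  shows "(\<lambda>n. weighted_recovery_prob n d (p n)) \<longlonglongrightarrow> 0"
proof -
  define C where "C = d choose 2"
  \<comment> \<open>\<kappa> \<ge> 1 - \<delta> yields n ^ 2 * n powr (- \<kappa>) \<le> n powr (1 +
    \<delta>), and \<kappa> \<ge> 0 keeps t bounded.\<close>
  define \<kappa> where "\<kappa> = max 0 (1 - \<delta>)"
  define a where "a = c / (2 * real d ^ d)"
  have a: "a > 0" using c d by (simp add: a_def)
  have "0 \<le> (real d - 1) / (real d + 1)" using d by simp
  then have \<delta>0: "\<delta> > 0" using gt by linarith
  have C2: "2 * real C = real d * (real d - 1)"
  proof -
    have "even (d * (d - 1))" by auto
    then have "2 * C = d * (d - 1)" by (simp add: C_def choose_two del: even_mult_iff even_diff_nat)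
    then have "real (2 * C) = real (d * (d - 1))" by (rule arg_cong)
    then show ?thesis using d by (simp add: of_nat_diff)
  qed
  \<comment> \<open>This makes the exponent of n in \<open>q\<close> negative. For \<delta> < 1,
    twice the difference of the sides factors as (d - 2) (\<delta> (d + 1) - (d - 1)), which is
    where the threshold enters; for \<delta> \<ge> 1 the claim is \<delta> < d - 1.\<close>
  have \<kappa>C: "\<kappa> * real C < real d - 1 - \<delta>"
  proof (cases "\<delta> \<ge> 1")
    case True
    then show ?thesis using \<delta>d by (simp add: \<kappa>_def)
  next
    case False
    have "(real d - 1) < \<delta> * (real d + 1)" using gt d by (simp add: pos_divide_less_eq)
    then have "0 < (real d - 2) * (\<delta> * (real d + 1) - (real d - 1))" using d by simp
    also have "\<dots> = 2 * (real d - 1 - \<delta>) - (1 - \<delta>) * (real d * (real d - 1))"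
      by (simp add: algebra_simps)
    also have "\<dots> = 2 * (real d - 1 - \<delta> - (1 - \<delta>) * real C)"
      unfolding C2[symmetric] by (simp add: algebra_simps)
    finally show ?thesis using False by (simp add: \<kappa>_def)
  qed
  \<comment> \<open>The factor 1 / 2 ensures t n \<le> 1 / 2, as
    \<open>inverse_one_minus_le_exp\<close> demands.\<close>
  define t where "t n = real n powr (- \<kappa>) / 2" for n
  define q where "q n = (c + \<epsilon> n) * 2 ^ C * real n powr (\<kappa> * real C - (real d - 1 - \<delta>))" for n
  define X where "X n = real n powr (1 + \<delta>)" for n
  have "(\<lambda>n. (c + \<epsilon> n) * real n powr (\<kappa> * real C - (real d - 1 - \<delta>)) * 2 ^ C) \<longlonglongrightarrow> 0"
    using \<kappa>C by (intro tendsto_mult_left_zero perturbed_const_tendsto \<epsilon>) auto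
  then have "q \<longlonglongrightarrow> 0" by (simp add: q_def[abs_def] mult_ac)
  \<comment> \<open>Since L \<ge> a * X n, this bound on q n gives q n powr (L / 4) \<le> exp (- 2 *
    X n), which beats the factor exp (X n) of the series.\<close>
  then have evq: "\<forall>\<^sub>F n in sequentially. q n < exp (- 8 / a)"
    by (rule order_tendstoD) simp
  have evp: "\<forall>\<^sub>F n in sequentially. p n < 1"
  proof -
    have "(\<lambda>n. (c + \<epsilon> n) * real n powr (- real d + 1 + \<delta>)) \<longlonglongrightarrow> 0"
      using \<delta>d by (intro perturbed_const_tendsto \<epsilon>) auto
    then have "\<forall>\<^sub>F n in sequentially. (c + \<epsilon> n) * real n powr (- real d + 1 + \<delta>) < 1"
      by (rule order_tendstoD) simp
    with p show ?thesis by eventually_elim simp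
  qed
  have bound: "\<forall>\<^sub>F n in sequentially.
      weighted_recovery_prob n d (p n) \<le> exp (- (a / 4) * X n) + exp (- 1 * X n)"
    using p evq evp eventually_perturbed_const_ge[OF c \<epsilon>] eventually_ge_at_top[of "d"]
  proof eventually_elim
    case (elim n)
    have n: "real n \<ge> 1" "n \<ge> 2" using elim(5) d by auto
    have pos: "0 < c + \<epsilon> n" using elim(4) c by linarith
    have p0: "0 < p n" using elim(1) pos n by simp
    have "real n powr (- \<kappa>) \<le> real n powr 0" using n by (intro powr_mono) (auto simp: \<kappa>_def)
    then have t: "0 < t n" "t n \<le> 1 / 2" using n by (auto simp: t_def)
    have ptq: "p n / t n ^ C = q n"
    proof -
      have "t n ^ C = real n powr (- \<kappa> * real C) / 2 ^ C"
        using n by (simp add: t_def power_divide powr_realpow[symmetric] powr_powr)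
      then have "p n / t n ^ C = (c + \<epsilon> n) * 2 ^ C *
          (real n powr (- real d + 1 + \<delta>) / real n powr (- \<kappa> * real C))"
        using elim(1) by simp
      also have "\<dots> = q n"
        by (simp add: q_def powr_diff[symmetric] algebra_simps)
      finally show ?thesis .
    qed
    have "exp (- 8 / a) \<le> 1" using a by simp
    then have "q n \<le> 1" using elim(2) by linarith
    then have pt: "p n \<le> t n ^ (d choose 2)"
      using t unfolding ptq[symmetric] C_def by (simp add: pos_divide_le_eq)
    define L where "L = real (n choose d) * p n"
    have L: "a * X n \<le> L"
      unfolding L_def a_def X_def elim(1) using d elim(4,5) c by (intro expected_edges_ge) auto
    have "0 \<le> a * X n" using a by (simp add: X_def)
    then have L0: "0 \<le> L" using L by linarith
    have q0: "0 \<le> q n" using pos by (simp add: q_def)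
    have "weighted_recovery_prob n d (p n)
        \<le> exp (- L / 4) + q n powr (L / 4) * (1 / (1 - t n)) ^ (n choose 2)"
      using weighted_recovery_prob_le[OF p0 _ t(1) _ pt, of n] elim(3) t ptq
      by (simp add: L_def C_def)
    also have "\<dots> \<le> exp (- (a / 4) * X n) + exp (- 2 * X n) * exp (X n)"
    proof (intro add_mono mult_mono)
      show "exp (- L / 4) \<le> exp (- (a / 4) * X n)" using L by simp
      have "q n powr (L / 4) \<le> exp (- 8 / a) powr (L / 4)"
        using elim(2) q0 L0 by (intro powr_mono2) auto
      also have "\<dots> = exp (- 2 * (L / a))" by (simp add: powr_def)
      also have "\<dots> \<le> exp (- 2 * X n)" using L a by (simp add: pos_le_divide_eq mult.commute)
      finally show "q n powr (L / 4) \<le> exp (- 2 * X n)" .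
      have "(1 / (1 - t n)) ^ (n choose 2) \<le> exp (2 * t n) ^ (n choose 2)"
        using t inverse_one_minus_le_exp[of "t n"] by (intro power_mono) auto
      also have "\<dots> \<le> exp (2 * t n) ^ (n ^ 2)"
        using t n by (intro power_increasing binomial_le_pow) auto
      also have "\<dots> = exp (real n powr (2 - \<kappa>))"
      proof -
        have "real (n ^ 2) * (2 * t n) = real n powr 2 * real n powr (- \<kappa>)"
          using n by (simp add: t_def powr_numeral)
        also have "\<dots> = real n powr (2 - \<kappa>)"
          using powr_add[of "real n" 2 "- \<kappa>"] by (simp only: diff_conv_add_uminus)
        finally show ?thesis by (simp only: exp_of_nat_mult[symmetric])
      qed
      also have "\<dots> \<le> exp (X n)"
        using n by (auto simp: X_def \<kappa>_def intro!: powr_mono)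
      finally show "(1 / (1 - t n)) ^ (n choose 2) \<le> exp (X n)" .
    qed (use t in auto)
    also have "exp (- 2 * X n) * exp (X n) = exp (- 1 * X n)"
      by (simp add: exp_add[symmetric])
    finally show ?case .
  qed
  have X: "filterlim X at_top sequentially"
  proof (rule filterlim_at_top_mono[OF filterlim_real_sequentially])
    show "\<forall>\<^sub>F n in sequentially. real n \<le> X n"
      using eventually_ge_at_top[of 1]
    proof eventually_elim
      case (elim n)
      then have "real n powr 1 \<le> real n powr (1 + \<delta>)" using \<delta>0 by (intro powr_mono) auto
      then show ?case using elim by (simp add: X_def)
    qed
  qed
  have exp0: "(\<lambda>n. exp (- b * X n)) \<longlonglongrightarrow> 0" if "b > 0" for b
  proof -
    have "filterlim (\<lambda>n. - b * X n) at_bot sequentially"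
      using that by (intro filterlim_tendsto_neg_mult_at_bot[OF tendsto_const _ X]) auto
    then show ?thesis by (rule filterlim_compose[OF exp_at_bot])
  qed
  have "(\<lambda>n. exp (- (a / 4) * X n) + exp (- 1 * X n)) \<longlonglongrightarrow> 0 + 0"
    using a by (intro tendsto_add exp0) auto
  then have "(\<lambda>n. exp (- (a / 4) * X n) + exp (- 1 * X n)) \<longlonglongrightarrow> 0" by simp
  from tendsto_sandwich[OF _ bound tendsto_const this] show ?thesis
    by (simp add: weighted_recovery_prob_nonneg)
qed

theorem theorem4:
  fixes d :: nat and \<delta> c :: real and p \<epsilon> :: "nat \<Rightarrow> real"
  assumes "d \<ge> 3"
    and "\<delta> < real d - 1"
    and "c > 0"
    and "\<epsilon> \<longlonglongrightarrow> 0"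
    and "\<forall>\<^sub>F n in sequentially. p n = (c + \<epsilon> n) * real n powr (- real d + 1 + \<delta>)"
  shows "(\<delta> < (real d - 1) / (real d + 1) \<longrightarrow>
            (\<lambda>n. weighted_recovery_prob n d (p n)) \<longlonglongrightarrow> 1) \<and>
         (\<delta> > (real d - 1) / (real d + 1) \<longrightarrow>
            (\<lambda>n. weighted_recovery_prob n d (p n)) \<longlonglongrightarrow> 0)"
  using weighted_recovery_tendsto_1[OF assms(1,3-5)] weighted_recovery_tendsto_0[OF assms] by blast

end
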